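(* Let $A$ be a finite commutative ring with identity, $\sigma$ a ring automorphism of $A$, $a\in U(A)$, and $\mathcal{C}=(g(X))^{a}_{n,\sigma}$ a principal $\sigma$-constacyclic code generated by some monic $g(X)=\sum_{i=0}^{n-k}g_iX^i\in A[X;\sigma]$ of degree $n-k$ with $g_0\in U(A)$. Let $h(X)=\sum_{i=0}^k h_iX^i\in A[X;\sigma]$ be such that $g(X)h(X)=X^n-\sigma^{-k}(a)$ (such $h$ exists). Then a generating matrix $H\in M_{n-k,n}(A)$ of $\mathcal{C}^\perp$ is $$\left( \begin{array}{ccccccc} h_{k} & \sigma(h_{k-1}) & \dots &\sigma^{k}( h_0) & 0& \dots & 0\\ 0 & \sigma(h_{k}) &\sigma^2(h_{k-1})& \dots & \sigma^{k+1}(h_0) &0 & \dots \\ \vdots & & & \vdots & \vdots & & \vdots \\ 0 & \dots & \dots & 0 & \sigma^{n-k-1}(h_{k}) & \dots &\sigma^{n-1}(h_0) \end{array} \right),$$ i.e. for $0\le t\le n-k-1$, row $t$ consists of $t$ zeros, followed by $\sigma^{t}(h_k),\sigma^{t+1}(h_{k-1}),\dots,\sigma^{t+k}(h_0)$, followed by zeros.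
   Context: $U(A)$ is the group of units of $A$. $A[X;\sigma]$ is the skew-polynomial ring of elements $\sum a_iX^i$ with multiplication determined by $Xa=\sigma(a)X$; $(p)_l$ is the left ideal generated by $p$. For $a\in U(A)$ and $g$ a right divisor of $X^n-a$ in $A[X;\sigma]$, the principal $\sigma$-constacyclic code $(g(X))_{n,\sigma}^a$ is the set of $(d_0,\dots,d_{n-1})\in A^n$ such that $\sum_{i=0}^{n-1} d_iX^i+(X^n-a)_l\in (g)_l/(X^n-a)_l$. The dual is $\mathcal{C}^\perp=\{y\in A^n:\sum_i x_iy_i=0\text{ for all }x\in\mathcal{C}\}$. A generating matrix of an $A$-free submodule of $A^n$ of rank $m$ is a matrix in $M_{m,n}(A)$ whose rows form an $A$-basis of it. *)

theory Defs
  imports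
    "HOL-Algebra.QuotRing"
    "HOL-Computational_Algebra.Polynomial"
    "Jordan_Normal_Form.VS_Connect"
begin

section \<open>Skew polynomials\<close>

text \<open>
  A skew polynomial with coefficients written on the left is represented by the ordinary
  polynomial with the same coefficients. Only the multiplication is twisted: it is the biadditive
  extension of \<open>(a X^i) (b X^j) = a \<sigma>^i(b) X^(i+j)\<close>.
\<close>

definition skew_mult :: "('a::comm_ring_1 \<Rightarrow> 'a) \<Rightarrow> 'a poly \<Rightarrow> 'a poly \<Rightarrow> 'a poly" where
  "skew_mult \<sigma> p q =
     (\<Sum>i\<le>degree p. \<Sum>j\<le>degree q. monom (coeff p i * (\<sigma> ^^ i) (coeff q j)) (i + j))"

definition skew_poly_ring :: "('a::comm_ring_1 \<Rightarrow> 'a) \<Rightarrow> 'a poly ring" where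
  "skew_poly_ring \<sigma> =
     \<lparr> carrier = UNIV, mult = skew_mult \<sigma>, one = 1, zero = 0, add = (+) \<rparr>"

section \<open>Left ideals and right divisors\<close>

definition left_ideal :: "('r, 'm) ring_scheme \<Rightarrow> 'r set \<Rightarrow> bool" where
  "left_ideal R I \<longleftrightarrow> additive_subgroup I R \<and> (\<forall>r\<in>carrier R. \<forall>x\<in>I. r \<otimes>\<^bsub>R\<^esub> x \<in> I)"

definition gen_left_ideal :: "('r, 'm) ring_scheme \<Rightarrow> 'r \<Rightarrow> 'r set" where
  "gen_left_ideal R p = \<Inter>{I. left_ideal R I \<and> p \<in> I}"

definition right_divisor :: "('r, 'm) ring_scheme \<Rightarrow> 'r \<Rightarrow> 'r \<Rightarrow> bool" where
  "right_divisor R g f \<longleftrightarrow> (\<exists>h\<in>carrier R. f = h \<otimes>\<^bsub>R\<^esub> g)"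

section \<open>Codes\<close>

text \<open>The modulus \<open>X^n - a\<close>.\<close>

definition constacyclic_poly :: "nat \<Rightarrow> 'a::comm_ring_1 \<Rightarrow> 'a poly" where
  "constacyclic_poly n a = monom 1 n - [:a:]"

text \<open>
  The two left ideals are \<open>I = (X^n - a)_l\<close> and \<open>J = (g)_l\<close>. The set \<open>(\<lambda>q. I +> q) ` J\<close> of cosets
  is \<open>J / I\<close>, viewed inside the quotient of the skew polynomial ring by \<open>I\<close>. The definition is only
  meant for \<open>a\<close> a unit and \<open>g\<close> a right divisor of \<open>X^n - a\<close>, so that \<open>I \<subseteq> J\<close>.
\<close>

definition constacyclic_code ::
  "('a::comm_ring_1 \<Rightarrow> 'a) \<Rightarrow> nat \<Rightarrow> 'a \<Rightarrow> 'a poly \<Rightarrow> 'a vec set" where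
  "constacyclic_code \<sigma> n a g =
     (let R = skew_poly_ring \<sigma>;
          I = gen_left_ideal R (constacyclic_poly n a);
          J = gen_left_ideal R g
      in {d \<in> carrier_vec n.
            I +>\<^bsub>R\<^esub> (\<Sum>i<n. monom (d $ i) i) \<in> (\<lambda>q. I +>\<^bsub>R\<^esub> q) ` J})"

definition dual_code :: "nat \<Rightarrow> 'a::comm_ring_1 vec set \<Rightarrow> 'a vec set" where
  "dual_code n C = {y \<in> carrier_vec n. \<forall>x\<in>C. x \<bullet> y = 0}"

text \<open>
  The rows of \<open>G\<close> form a basis of \<open>M\<close> as a family: since linear independence is a property of
  sets, distinctness of the rows has to be required separately.
\<close>

definition generating_matrix :: "nat \<Rightarrow> nat \<Rightarrow> 'a::comm_ring_1 mat \<Rightarrow> 'a vec set \<Rightarrow> bool" where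
  "generating_matrix m n G M \<longleftrightarrow>
     G \<in> carrier_mat m n \<and>
     submodule class_ring M (module_vec TYPE('a) n) \<and>
     distinct (rows G) \<and>
     \<not> LinearCombinations.module.lin_dep class_ring (module_vec TYPE('a) n) (set (rows G)) \<and>
     LinearCombinations.module.span class_ring (module_vec TYPE('a) n) (set (rows G)) = M"

text \<open>
  Row \<open>t\<close> has the entry \<open>\<sigma>^(t+i)(h_(k-i))\<close> in column \<open>j = t + i\<close> for \<open>0 \<le> i \<le> k\<close>, and zeros elsewhere.
\<close>

definition dual_matrix :: "('a::comm_ring_1 \<Rightarrow> 'a) \<Rightarrow> nat \<Rightarrow> nat \<Rightarrow> 'a poly \<Rightarrow> 'a mat" where
  "dual_matrix \<sigma> n k h =
     mat (n - k) n (\<lambda>(t, j). if t \<le> j \<and> j \<le> t + k then (\<sigma> ^^ j) (coeff h (t + k - j)) else 0)"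

section \<open>The skew polynomials form a ring\<close>

lemma ring_auto_simps:
  fixes \<sigma> :: "'a::comm_ring_1 \<Rightarrow> 'a"
  assumes "\<sigma> \<in> ring_iso class_ring class_ring"
  shows "\<sigma> (x + y) = \<sigma> x + \<sigma> y" "\<sigma> (x * y) = \<sigma> x * \<sigma> y" "\<sigma> 1 = 1" "\<sigma> 0 = 0" "bij \<sigma>"
proof -
  show add: "\<sigma> (x + y) = \<sigma> x + \<sigma> y" for x y
    using assms by (auto simp: ring_iso_def Ring.ring_hom_def)
  show "\<sigma> (x * y) = \<sigma> x * \<sigma> y" "\<sigma> 1 = 1" "bij \<sigma>"
    using assms by (auto simp: ring_iso_def Ring.ring_hom_def)
  have "\<sigma> 0 + \<sigma> 0 = \<sigma> 0 + 0"
    by (simp flip: add)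
  then show "\<sigma> 0 = 0" by (rule add_left_imp_eq)
qed

lemma ring_auto_funpow:
  fixes \<sigma> :: "'a::comm_ring_1 \<Rightarrow> 'a"
  assumes "\<sigma> \<in> ring_iso class_ring class_ring"
  shows "(\<sigma> ^^ i) (x + y) = (\<sigma> ^^ i) x + (\<sigma> ^^ i) y"
    "(\<sigma> ^^ i) (x * y) = (\<sigma> ^^ i) x * (\<sigma> ^^ i) y" "(\<sigma> ^^ i) 1 = 1" "(\<sigma> ^^ i) 0 = 0"
  by (induct i) (simp_all add: ring_auto_simps(1-4)[OF assms])

lemma skew_mult_bound:
  fixes \<sigma> :: "'a::comm_ring_1 \<Rightarrow> 'a"
  assumes \<sigma>: "\<sigma> \<in> ring_iso class_ring class_ring"
    and "degree p \<le> N" "degree q \<le> M"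
  shows "skew_mult \<sigma> p q =
    (\<Sum>i\<le>N. \<Sum>j\<le>M. monom (coeff p i * (\<sigma> ^^ i) (coeff q j)) (i + j))"
proof -
  have "(\<Sum>j\<le>M. monom (coeff p i * (\<sigma> ^^ i) (coeff q j)) (i + j)) =
    (\<Sum>j\<le>degree q. monom (coeff p i * (\<sigma> ^^ i) (coeff q j)) (i + j))" for i
    using assms(3) by (intro sum.mono_neutral_right)
      (auto simp: coeff_eq_0 ring_auto_funpow(4)[OF \<sigma>])
  moreover have "(\<Sum>i\<le>N. \<Sum>j\<le>degree q. monom (coeff p i * (\<sigma> ^^ i) (coeff q j)) (i + j)) =
    (\<Sum>i\<le>degree p. \<Sum>j\<le>degree q. monom (coeff p i * (\<sigma> ^^ i) (coeff q j)) (i + j))"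
    using assms(2) by (intro sum.mono_neutral_right) (auto simp: coeff_eq_0)
  ultimately show ?thesis by (simp add: skew_mult_def)
qed

lemma skew_mult_add_left:
  fixes \<sigma> :: "'a::comm_ring_1 \<Rightarrow> 'a"
  assumes \<sigma>: "\<sigma> \<in> ring_iso class_ring class_ring"
  shows "skew_mult \<sigma> (p + p') q = skew_mult \<sigma> p q + skew_mult \<sigma> p' q"
proof -
  define N where "N = max (degree p) (degree p')"
  have N: "degree p \<le> N" "degree p' \<le> N" "degree (p + p') \<le> N"
    by (auto simp: N_def degree_add_le_max)
  show ?thesis
    unfolding N[THEN skew_mult_bound[OF \<sigma> _ order_refl]]
    by (simp add: distrib_right sum.distrib flip: add_monom)
qed

lemma skew_mult_add_right:
  fixes \<sigma> :: "'a::comm_ring_1 \<Rightarrow> 'a"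
  assumes \<sigma>: "\<sigma> \<in> ring_iso class_ring class_ring"
  shows "skew_mult \<sigma> p (q + q') = skew_mult \<sigma> p q + skew_mult \<sigma> p q'"
proof -
  define N where "N = max (degree q) (degree q')"
  have N: "degree q \<le> N" "degree q' \<le> N" "degree (q + q') \<le> N"
    by (auto simp: N_def degree_add_le_max)
  show ?thesis
    unfolding N[THEN skew_mult_bound[OF \<sigma> order_refl]]
    by (simp add: distrib_left sum.distrib ring_auto_funpow(1)[OF \<sigma>] flip: add_monom)
qed

lemma skew_mult_0 [simp]:
  fixes \<sigma> :: "'a::comm_ring_1 \<Rightarrow> 'a"
  assumes \<sigma>: "\<sigma> \<in> ring_iso class_ring class_ring"
  shows "skew_mult \<sigma> 0 q = 0" "skew_mult \<sigma> p 0 = 0"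
  using skew_mult_add_left[OF \<sigma>, of 0 0 q] skew_mult_add_right[OF \<sigma>, of p 0 0] by simp_all

lemma skew_mult_monom:
  fixes \<sigma> :: "'a::comm_ring_1 \<Rightarrow> 'a"
  assumes \<sigma>: "\<sigma> \<in> ring_iso class_ring class_ring"
  shows "skew_mult \<sigma> (monom a i) (monom b j) = monom (a * (\<sigma> ^^ i) b) (i + j)"
proof -
  have "skew_mult \<sigma> (monom a i) (monom b j) = (\<Sum>i'\<le>i. \<Sum>j'\<le>j.
      monom (coeff (monom a i) i' * (\<sigma> ^^ i') (coeff (monom b j) j')) (i' + j'))"
    by (rule skew_mult_bound[OF \<sigma>]) (simp_all add: degree_monom_le)
  also have "\<dots> = (\<Sum>i'\<le>i. \<Sum>j'\<le>j.
      if i' = i \<and> j' = j then monom (a * (\<sigma> ^^ i) b) (i + j) else 0)"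
    by (intro sum.cong) (auto simp: ring_auto_funpow(4)[OF \<sigma>])
  also have "\<dots> = (\<Sum>i'\<le>i. if i' = i then monom (a * (\<sigma> ^^ i) b) (i + j) else 0)"
    by (intro sum.cong) auto
  also have "\<dots> = monom (a * (\<sigma> ^^ i) b) (i + j)" by simp
  finally show ?thesis .
qed

text \<open>The defining relation \<open>X a = \<sigma>(a) X\<close>.\<close>

lemma skew_mult_X_const:
  fixes \<sigma> :: "'a::comm_ring_1 \<Rightarrow> 'a"
  assumes \<sigma>: "\<sigma> \<in> ring_iso class_ring class_ring"
  shows "skew_mult \<sigma> (monom 1 1) [:a:] = skew_mult \<sigma> [:\<sigma> a:] (monom 1 1)"
  using skew_mult_monom[OF \<sigma>, of 1 1 a 0] skew_mult_monom[OF \<sigma>, of "\<sigma> a" 0 1 1]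
  by (simp add: monom_0 flip: one_pCons)

lemma poly_additive_induct:
  assumes "\<And>a i. P (monom a i)" and "\<And>p q. P p \<Longrightarrow> P q \<Longrightarrow> P (p + q)"
  shows "P (p :: 'a::comm_ring_1 poly)"
proof -
  have "P (\<Sum>i\<le>m. monom (coeff p i) i)" for m
    by (induction m) (auto intro: assms)
  then show ?thesis using poly_as_sum_of_monoms[of p] by metis
qed

lemma skew_mult_assoc:
  fixes \<sigma> :: "'a::comm_ring_1 \<Rightarrow> 'a"
  assumes \<sigma>: "\<sigma> \<in> ring_iso class_ring class_ring"
  shows "skew_mult \<sigma> (skew_mult \<sigma> p q) r = skew_mult \<sigma> p (skew_mult \<sigma> q r)"
proof (induction p rule: poly_additive_induct)
  case p: (1 a i)
  show ?case
  proof (induction q rule: poly_additive_induct)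
    case q: (1 b j)
    show ?case
    proof (induction r rule: poly_additive_induct)
      case (1 c l)
      show ?case
        by (simp add: skew_mult_monom[OF \<sigma>] ring_auto_funpow(2)[OF \<sigma>] funpow_add
            add.assoc mult.assoc)
    qed (simp add: skew_mult_add_right[OF \<sigma>])
  qed (simp add: skew_mult_add_right[OF \<sigma>] skew_mult_add_left[OF \<sigma>])
qed (simp add: skew_mult_add_left[OF \<sigma>])

lemma skew_mult_1:
  fixes \<sigma> :: "'a::comm_ring_1 \<Rightarrow> 'a"
  assumes \<sigma>: "\<sigma> \<in> ring_iso class_ring class_ring"
  shows "skew_mult \<sigma> 1 p = p" "skew_mult \<sigma> p 1 = p"
proof -
  show "skew_mult \<sigma> 1 p = p"
  proof (induction p rule: poly_additive_induct)
    case (1 a i)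
    then show ?case using skew_mult_monom[OF \<sigma>, of 1 0 a i] by (simp add: monom_0 flip: one_pCons)
  qed (simp add: skew_mult_add_right[OF \<sigma>])
  show "skew_mult \<sigma> p 1 = p"
  proof (induction p rule: poly_additive_induct)
    case (1 a i)
    then show ?case
      using skew_mult_monom[OF \<sigma>, of a i 1 0] by (simp add: monom_0 ring_auto_funpow(3)[OF \<sigma>] flip: one_pCons)
  qed (simp add: skew_mult_add_left[OF \<sigma>])
qed

lemma ring_skew_poly_ring:
  fixes \<sigma> :: "'a::comm_ring_1 \<Rightarrow> 'a"
  assumes \<sigma>: "\<sigma> \<in> ring_iso class_ring class_ring"
  shows "Ring.ring (skew_poly_ring \<sigma>)"
proof (rule ringI)
  show "abelian_group (skew_poly_ring \<sigma>)"
  proof (rule abelian_groupI)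
    fix x assume "x \<in> carrier (skew_poly_ring \<sigma>)"
    show "\<exists>y\<in>carrier (skew_poly_ring \<sigma>).
        y \<oplus>\<^bsub>skew_poly_ring \<sigma>\<^esub> x = \<zero>\<^bsub>skew_poly_ring \<sigma>\<^esub>"
      by (rule bexI[of _ "- x"]) (auto simp: skew_poly_ring_def)
  qed (auto simp: skew_poly_ring_def)
  show "Group.monoid (skew_poly_ring \<sigma>)"
    by standard (auto simp: skew_poly_ring_def skew_mult_assoc[OF \<sigma>] skew_mult_1[OF \<sigma>])
qed (auto simp: skew_poly_ring_def skew_mult_add_left[OF \<sigma>] skew_mult_add_right[OF \<sigma>])

lemma (in Ring.ring) gen_left_ideal_eq:
  assumes p: "p \<in> carrier R"
  shows "gen_left_ideal R p = (\<lambda>r. r \<otimes> p) ` carrier R"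
proof
  have "additive_subgroup ((\<lambda>r. r \<otimes> p) ` carrier R) R"
  proof (rule additive_subgroup.intro, rule add.subgroupI)
    fix x assume "x \<in> (\<lambda>r. r \<otimes> p) ` carrier R"
    then obtain r where "r \<in> carrier R" "x = r \<otimes> p" by auto
    then have "\<ominus> x = (\<ominus> r) \<otimes> p" using p by (simp add: l_minus)
    then show "\<ominus> x \<in> (\<lambda>r. r \<otimes> p) ` carrier R" using \<open>r \<in> carrier R\<close> by auto
  next
    fix x y assume "x \<in> (\<lambda>r. r \<otimes> p) ` carrier R" "y \<in> (\<lambda>r. r \<otimes> p) ` carrier R"
    then obtain r s where "r \<in> carrier R" "x = r \<otimes> p" "s \<in> carrier R" "y = s \<otimes> p" by auto
    then have "x \<oplus> y = (r \<oplus> s) \<otimes> p" using p by (simp add: l_distr)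
    then show "x \<oplus> y \<in> (\<lambda>r. r \<otimes> p) ` carrier R"
      using \<open>r \<in> carrier R\<close> \<open>s \<in> carrier R\<close> by auto
  qed (use p in auto)
  moreover have "r \<otimes> x \<in> (\<lambda>r. r \<otimes> p) ` carrier R"
    if r: "r \<in> carrier R" and x: "x \<in> (\<lambda>r. r \<otimes> p) ` carrier R" for r x
  proof -
    from x obtain s where "s \<in> carrier R" "x = s \<otimes> p" by auto
    then have "r \<otimes> x = (r \<otimes> s) \<otimes> p" using p r by (simp add: m_assoc)
    then show ?thesis using r \<open>s \<in> carrier R\<close> by auto
  qed
  ultimately have "left_ideal R ((\<lambda>r. r \<otimes> p) ` carrier R)"
    by (auto simp: left_ideal_def)
  moreover have "p \<in> (\<lambda>r. r \<otimes> p) ` carrier R"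
    using p by (intro image_eqI[of _ _ \<one>]) auto
  ultimately show "gen_left_ideal R p \<subseteq> (\<lambda>r. r \<otimes> p) ` carrier R"
    by (auto simp: gen_left_ideal_def)
qed (auto simp: gen_left_ideal_def left_ideal_def)

end

theory Submission
  imports Defs
begin

text \<open>
  Put \<open>m = n - k\<close> and write \<open>\<Theta>\<close> for \<open>\<sigma>^n\<close> applied to all coefficients, so that
  \<open>X^n p = \<Theta>(p) X^n\<close>. Let \<open>h' g = X^n - a\<close>.

  \<^bold>\<open>Existence of \<open>h\<close>.\<close> The polynomial \<open>(X^n - \<sigma>^m(a)) g - \<Theta>(g) (X^n - a) = \<Theta>(g) a - \<sigma>^m(a) g\<close> lies
  in the left ideal of \<open>g\<close>, and its terms of degree \<open>m\<close> cancel because \<open>g\<close> is monic. A nonzero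
  left multiple of a monic polynomial has at least its degree, so the difference vanishes, and
  cancelling \<open>g\<close> gives \<open>\<Theta>(g) h' = X^n - \<sigma>^m(a)\<close>. The inverse of the ring automorphism \<open>\<Theta>\<close> turns this
  into \<open>g \<Theta>^(-1)(h') = X^n - \<sigma>^(-k)(a)\<close> (lemma \<open>monic_left_divisor\<close>).

  \<^bold>\<open>The dual code.\<close> The code consists of the coefficient vectors of the multiples \<open>r g\<close> with
  \<open>deg r < k\<close>, so it is spanned by \<open>g, X g, ..., X^(k-1) g\<close>. Hence \<open>y\<close> lies in the dual iff it
  satisfies the \<open>k\<close> parity checks \<open>\<Sum>j. \<sigma>^i(g(j)) y(i+j) = 0\<close> (lemma \<open>dual_code_eq_parity_checks\<close>).
  Check \<open>i\<close> on row \<open>t\<close> of the matrix is \<open>\<sigma>^i\<close> of the coefficient of \<open>g h\<close> at \<open>t + k - i\<close>, which is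
  strictly between \<open>0\<close> and \<open>n\<close>, so the rows lie in the dual (lemma \<open>dual_matrix_parity_checks\<close>).

  \<^bold>\<open>The rows form a basis.\<close> As \<open>g\<close> is monic, the checks express each of the last \<open>k\<close> entries of \<open>y\<close>
  by earlier ones, so the first \<open>m\<close> entries determine \<open>y\<close> (lemma \<open>parity_checks_determine_tail\<close>).
  The first \<open>m\<close> columns of the matrix are upper unitriangular, since \<open>h\<close> has coefficient \<open>1\<close> at
  \<open>k\<close>. Over any commutative ring these two facts give a basis by elimination
  (lemma \<open>unitriangular_generating_matrix\<close>).
\<close>

section \<open>Coefficients of skew products\<close>

context
  fixes \<sigma> :: "'a::comm_ring_1 \<Rightarrow> 'a"
  assumes \<sigma>: "\<sigma> \<in> ring_iso class_ring class_ring"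
begin

lemma funpow_sum: "(\<sigma> ^^ i) (sum f A) = (\<Sum>x\<in>A. (\<sigma> ^^ i) (f x))"
  by (induct A rule: infinite_finite_induct) (simp_all add: ring_auto_funpow[OF \<sigma>])

lemma funpow_minus: "(\<sigma> ^^ i) (- x) = - (\<sigma> ^^ i) x"
  using ring_auto_funpow(1)[OF \<sigma>, of i "- x" x] ring_auto_funpow(4)[OF \<sigma>, of i]
  by (simp add: eq_neg_iff_add_eq_0)

lemma skew_mult_diff_left: "skew_mult \<sigma> (p - p') q = skew_mult \<sigma> p q - skew_mult \<sigma> p' q"
  using skew_mult_add_left[OF \<sigma>, of "p - p'" p' q] by simp

lemma skew_mult_diff_right: "skew_mult \<sigma> p (q - q') = skew_mult \<sigma> p q - skew_mult \<sigma> p q'"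
  using skew_mult_add_right[OF \<sigma>, of p "q - q'" q'] by simp

lemma coeff_skew_mult:
  "coeff (skew_mult \<sigma> p q) l = (\<Sum>i\<le>l. coeff p i * (\<sigma> ^^ i) (coeff q (l - i)))"
proof (induction p rule: poly_additive_induct)
  case p: (1 a i)
  show ?case
  proof (induction q rule: poly_additive_induct)
    case (1 b j)
    have "(\<Sum>i'\<le>l. coeff (monom a i) i' * (\<sigma> ^^ i') (coeff (monom b j) (l - i'))) =
        (\<Sum>i'\<le>l. if i' = i then a * (\<sigma> ^^ i) (coeff (monom b j) (l - i)) else 0)"
      by (intro sum.cong) auto
    also have "\<dots> = coeff (monom (a * (\<sigma> ^^ i) b) (i + j)) l"
      by (auto simp: ring_auto_funpow(4)[OF \<sigma>])
    finally show ?case by (simp add: skew_mult_monom[OF \<sigma>])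
  qed (simp add: skew_mult_add_right[OF \<sigma>] ring_auto_funpow(1)[OF \<sigma>] distrib_left sum.distrib)
qed (simp add: skew_mult_add_left[OF \<sigma>] distrib_right sum.distrib)

lemma coeff_monom_skew_mult:
  "coeff (skew_mult \<sigma> (monom 1 i) g) l = (if i \<le> l then (\<sigma> ^^ i) (coeff g (l - i)) else 0)"
proof -
  have "coeff (skew_mult \<sigma> (monom 1 i) g) l =
      (\<Sum>i'\<le>l. if i' = i then (\<sigma> ^^ i) (coeff g (l - i)) else 0)"
    unfolding coeff_skew_mult by (intro sum.cong) auto
  then show ?thesis by simp
qed

lemma coeff_skew_mult_monom:
  "coeff (skew_mult \<sigma> p (monom c j)) l =
    (if j \<le> l then coeff p (l - j) * (\<sigma> ^^ (l - j)) c else 0)"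
proof -
  have "coeff (skew_mult \<sigma> p (monom c j)) l =
      (\<Sum>i\<le>l. if i = l - j \<and> j \<le> l then coeff p (l - j) * (\<sigma> ^^ (l - j)) c else 0)"
    unfolding coeff_skew_mult by (intro sum.cong) (auto simp: ring_auto_funpow(4)[OF \<sigma>])
  then show ?thesis by (cases "j \<le> l") auto
qed

lemma coeff_const_skew_mult: "coeff (skew_mult \<sigma> [:c:] q) l = c * coeff q l"
proof -
  have "coeff (skew_mult \<sigma> [:c:] q) l = (\<Sum>i\<le>l. if i = 0 then c * coeff q l else 0)"
    unfolding coeff_skew_mult by (intro sum.cong) (auto simp: coeff_pCons split: nat.splits)
  then show ?thesis by simp
qed

lemma coeff_skew_mult_top:
  "coeff (skew_mult \<sigma> p q) (degree p + degree q) = lead_coeff p * (\<sigma> ^^ degree p) (lead_coeff q)"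
proof -
  have "coeff (skew_mult \<sigma> p q) (degree p + degree q) =
      (\<Sum>i\<le>degree p + degree q. if i = degree p
         then lead_coeff p * (\<sigma> ^^ degree p) (lead_coeff q) else 0)"
    unfolding coeff_skew_mult
  proof (intro sum.cong refl)
    fix i
    consider "i < degree p" | "i = degree p" | "i > degree p" by linarith
    then show "coeff p i * (\<sigma> ^^ i) (coeff q (degree p + degree q - i)) =
        (if i = degree p then lead_coeff p * (\<sigma> ^^ degree p) (lead_coeff q) else 0)"
    proof cases
      case 1
      then have "coeff q (degree p + degree q - i) = 0" by (intro coeff_eq_0) auto
      then show ?thesis using 1 by (simp add: ring_auto_funpow(4)[OF \<sigma>])
    qed (auto simp: coeff_eq_0)
  qed
  then show ?thesis by simp
qed

text \<open>
  Left multiplication by \<open>r\<close> puts the unit \<open>\<sigma>^(deg r)(1) = 1\<close> next to the leading coefficient of \<open>r\<close>,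
  so a monic right factor never lets the top term vanish, even over a ring with zero divisors.
\<close>

lemma degree_left_factor_less:
  assumes "lead_coeff g = 1" and "\<And>l. N \<le> l \<Longrightarrow> coeff (skew_mult \<sigma> r g) l = 0" and "r \<noteq> 0"
  shows "degree r + degree g < N"
proof (rule ccontr)
  assume "\<not> ?thesis"
  then have "coeff (skew_mult \<sigma> r g) (degree r + degree g) = 0" using assms(2) by simp
  then show False
    using assms(1,3) by (simp add: coeff_skew_mult_top ring_auto_funpow(3)[OF \<sigma>])
qed

lemma skew_mult_eq_0_left:
  assumes "lead_coeff g = 1" and "\<And>l. degree g \<le> l \<Longrightarrow> coeff (skew_mult \<sigma> r g) l = 0"
  shows "r = 0"
  using degree_left_factor_less[OF assms] by fastforce

text \<open>
  Acting on coefficients is multiplicative only for maps that commute with \<open>\<sigma>\<close>; it is applied to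
  powers of the inverse of \<open>\<sigma>\<close>.
\<close>

lemma map_poly_skew_mult:
  assumes \<phi>: "\<phi> \<in> ring_iso class_ring class_ring" and comm: "\<And>x. \<phi> (\<sigma> x) = \<sigma> (\<phi> x)"
  shows "map_poly \<phi> (skew_mult \<sigma> p q) = skew_mult \<sigma> (map_poly \<phi> p) (map_poly \<phi> q)"
proof -
  note \<phi>_simps = ring_auto_simps[OF \<phi>]
  have pow: "\<phi> ((\<sigma> ^^ i) x) = (\<sigma> ^^ i) (\<phi> x)" for i x
    by (induct i) (simp_all add: comm)
  have sum: "\<phi> (sum f A) = (\<Sum>x\<in>A. \<phi> (f x))" for f :: "nat \<Rightarrow> 'a" and A
    by (induct A rule: infinite_finite_induct) (simp_all add: \<phi>_simps)
  show ?thesis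
    by (rule poly_eqI) (simp add: coeff_map_poly \<phi>_simps coeff_skew_mult sum pow)
qed

section \<open>The cofactor on the other side\<close>

text \<open>
  The moduli \<open>X^n - a\<close> and \<open>X^n - \<sigma>^m(a)\<close> are related by moving \<open>g\<close> across \<open>X^n\<close>: the difference
  between \<open>(X^n - \<sigma>^m(a)) g\<close> and \<open>\<Theta>(g) h' g\<close> is a left multiple of \<open>g\<close> of degree below \<open>deg g\<close>. The
  exponent \<open>m = deg g\<close> is the one for which the terms of degree \<open>m\<close> cancel.
\<close>

lemma monic_right_divisor_twist:
  assumes lc: "lead_coeff g = 1" and h': "skew_mult \<sigma> h' g = constacyclic_poly n a"
  shows "skew_mult \<sigma> (map_poly (\<sigma> ^^ n) g) h' = constacyclic_poly n ((\<sigma> ^^ degree g) a)"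
proof -
  let ?\<Theta>g = "map_poly (\<sigma> ^^ n) g" and ?c = "(\<sigma> ^^ degree g) a"
  let ?r = "constacyclic_poly n ?c - skew_mult \<sigma> ?\<Theta>g h'"
  note map = coeff_map_poly[of "\<sigma> ^^ n", OF ring_auto_funpow(4)[OF \<sigma>]]
  have comm: "skew_mult \<sigma> (monom 1 n) g = skew_mult \<sigma> ?\<Theta>g (monom 1 n)"
    by (rule poly_eqI)
      (simp add: coeff_monom_skew_mult coeff_skew_mult_monom map ring_auto_funpow[OF \<sigma>])
  have "skew_mult \<sigma> ?r g =
      skew_mult \<sigma> (constacyclic_poly n ?c) g - skew_mult \<sigma> ?\<Theta>g (constacyclic_poly n a)"
    by (simp add: skew_mult_diff_left skew_mult_assoc[OF \<sigma>] h')
  also have "\<dots> = skew_mult \<sigma> ?\<Theta>g [:a:] - skew_mult \<sigma> [:?c:] g"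
    by (simp add: constacyclic_poly_def skew_mult_diff_left skew_mult_diff_right comm)
  finally have r: "coeff (skew_mult \<sigma> ?r g) l =
      (\<sigma> ^^ n) (coeff g l) * (\<sigma> ^^ l) a - ?c * coeff g l" for l
    using coeff_skew_mult_monom[of ?\<Theta>g a 0 l]
    by (simp add: coeff_const_skew_mult map monom_0)
  have "coeff (skew_mult \<sigma> ?r g) l = 0" if "degree g \<le> l" for l
  proof (cases "l = degree g")
    case True
    then show ?thesis using lc by (simp add: r ring_auto_funpow(3)[OF \<sigma>])
  next
    case False
    then show ?thesis using that by (simp add: r coeff_eq_0 ring_auto_funpow(4)[OF \<sigma>])
  qed
  then have "?r = 0" by (rule skew_mult_eq_0_left[OF lc])
  then show ?thesis by simp
qed

lemma inv_ring_auto: "inv_into UNIV \<sigma> \<in> ring_iso class_ring class_ring"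
  using ring_iso_set_sym[OF class_ring.ring_axioms \<sigma>] by simp

lemma ring_auto_inv: "\<sigma> (inv_into UNIV \<sigma> x) = x" "inv_into UNIV \<sigma> (\<sigma> x) = x"
  using ring_auto_simps(5)[OF \<sigma>] by (auto simp: bij_def surj_f_inv_f)

lemma funpow_inv: "(inv_into UNIV \<sigma> ^^ i) ((\<sigma> ^^ i) x) = x"
  by (induct i arbitrary: x) (simp_all add: ring_auto_inv funpow_swap1)

lemma funpow_ring_auto: "(\<sigma> ^^ i) \<in> ring_iso class_ring class_ring"
proof -
  have "bij (\<sigma> ^^ i)" using ring_auto_simps(5)[OF \<sigma>] by (rule bij_fn)
  then show ?thesis by (auto simp: ring_iso_def Ring.ring_hom_def ring_auto_funpow[OF \<sigma>])
qed

end

text \<open>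
  Undoing \<open>\<Theta>\<close> replaces \<open>\<sigma>^(n-k)(a)\<close> by \<open>\<sigma>^(-k)(a)\<close> and produces the cofactor explicitly, with
  degree at most that of \<open>h'\<close>.
\<close>

lemma monic_left_divisor:
  fixes \<sigma> :: "'a::comm_ring_1 \<Rightarrow> 'a"
  assumes \<sigma>: "\<sigma> \<in> ring_iso class_ring class_ring"
    and lc: "lead_coeff g = 1" and deg: "degree g = n - k" and k: "k \<le> n"
    and h': "skew_mult \<sigma> h' g = constacyclic_poly n a"
  shows "skew_mult \<sigma> g (map_poly (inv_into UNIV \<sigma> ^^ n) h') =
    constacyclic_poly n ((inv_into UNIV \<sigma> ^^ k) a)"
proof -
  let ?\<tau> = "inv_into UNIV \<sigma>"
  define \<phi> where "\<phi> = ?\<tau> ^^ n"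
  have \<phi>: "\<phi> \<in> ring_iso class_ring class_ring"
    unfolding \<phi>_def by (rule funpow_ring_auto[OF inv_ring_auto[OF \<sigma>]])
  have \<phi>_minus: "\<phi> (- x) = - \<phi> x" for x
    unfolding \<phi>_def by (rule funpow_minus[OF inv_ring_auto[OF \<sigma>]])
  have comm: "\<phi> (\<sigma> x) = \<sigma> (\<phi> x)" for x
    unfolding \<phi>_def by (induct n arbitrary: x) (simp_all add: ring_auto_inv[OF \<sigma>])
  have \<phi>_diff: "\<phi> (x - y) = \<phi> x - \<phi> y" for x y
    using ring_auto_simps(1)[OF \<phi>, of x "- y"] by (simp add: \<phi>_minus)
  have \<phi>_inv: "\<phi> ((\<sigma> ^^ n) x) = x" for x
    by (simp add: \<phi>_def funpow_inv[OF \<sigma>])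
  have \<phi>g: "map_poly \<phi> (map_poly (\<sigma> ^^ n) g) = g"
    by (rule poly_eqI) (simp add: coeff_map_poly ring_auto_simps(4)[OF \<phi>]
        ring_auto_funpow(4)[OF \<sigma>] \<phi>_inv)
  have "?\<tau> ^^ n = ?\<tau> ^^ k \<circ> ?\<tau> ^^ (n - k)" using k by (simp flip: funpow_add)
  then have \<phi>a: "\<phi> ((\<sigma> ^^ (n - k)) a) = (?\<tau> ^^ k) a"
    by (simp add: \<phi>_def funpow_inv[OF \<sigma>])
  have const: "map_poly \<phi> (constacyclic_poly n c) = constacyclic_poly n (\<phi> c)" for c
    by (rule poly_eqI) (auto simp: coeff_map_poly \<phi>_minus ring_auto_simps(3,4)[OF \<phi>]
        \<phi>_diff constacyclic_poly_def coeff_pCons split: nat.splits)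
  have "skew_mult \<sigma> g (map_poly \<phi> h') =
      map_poly \<phi> (skew_mult \<sigma> (map_poly (\<sigma> ^^ n) g) h')"
    by (simp add: map_poly_skew_mult[OF \<sigma> \<phi> comm] \<phi>g)
  also have "\<dots> = map_poly \<phi> (constacyclic_poly n ((\<sigma> ^^ (n - k)) a))"
    using monic_right_divisor_twist[OF \<sigma> lc h'] deg by simp
  also have "\<dots> = constacyclic_poly n ((?\<tau> ^^ k) a)"
    by (simp add: const \<phi>a)
  finally show ?thesis by (simp add: \<phi>_def)
qed

section \<open>The dual code as a set of parity checks\<close>

context
  fixes \<sigma> :: "'a::comm_ring_1 \<Rightarrow> 'a"
  assumes \<sigma>: "\<sigma> \<in> ring_iso class_ring class_ring"
begin

lemma gen_left_ideal_skew:
  "gen_left_ideal (skew_poly_ring \<sigma>) p = range (\<lambda>r. skew_mult \<sigma> r p)"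
  using ring.gen_left_ideal_eq[OF ring_skew_poly_ring[OF \<sigma>], of p]
  by (simp add: skew_poly_ring_def)

text \<open>
  The left ideal of \<open>X^n - a\<close> is contained in that of \<open>g\<close>, so membership of a coset in the quotient is
  membership of any representative in the latter.
\<close>

lemma constacyclic_code_eq:
  assumes h': "skew_mult \<sigma> h' g = constacyclic_poly n a"
  shows "constacyclic_code \<sigma> n a g =
    {d \<in> carrier_vec n. \<exists>r. (\<Sum>i<n. monom (d $ i) i) = skew_mult \<sigma> r g}"
proof -
  let ?R = "skew_poly_ring \<sigma>"
  let ?I = "gen_left_ideal ?R (constacyclic_poly n a)" and ?J = "gen_left_ideal ?R g"
  have coset: "?I +>\<^bsub>?R\<^esub> q = (\<lambda>i. i + q) ` ?I" for q
    by (auto simp: a_r_coset_def r_coset_def skew_poly_ring_def)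
  have "?I +>\<^bsub>?R\<^esub> p \<in> (\<lambda>q. ?I +>\<^bsub>?R\<^esub> q) ` ?J \<longleftrightarrow> (\<exists>r. p = skew_mult \<sigma> r g)" for p
  proof
    assume "?I +>\<^bsub>?R\<^esub> p \<in> (\<lambda>q. ?I +>\<^bsub>?R\<^esub> q) ` ?J"
    then obtain s where s: "?I +>\<^bsub>?R\<^esub> p = ?I +>\<^bsub>?R\<^esub> (skew_mult \<sigma> s g)"
      by (auto simp: gen_left_ideal_skew)
    have "0 \<in> ?I" using skew_mult_0(1)[OF \<sigma>] by (auto simp: gen_left_ideal_skew image_iff)
    then have "p \<in> ?I +>\<^bsub>?R\<^esub> p" by (force simp: coset)
    then have "p \<in> ?I +>\<^bsub>?R\<^esub> skew_mult \<sigma> s g" by (simp only: s)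
    then obtain u where "p = skew_mult \<sigma> u (constacyclic_poly n a) + skew_mult \<sigma> s g"
      unfolding coset by (auto simp: gen_left_ideal_skew)
    then have "p = skew_mult \<sigma> (skew_mult \<sigma> u h' + s) g"
      by (simp add: skew_mult_add_left[OF \<sigma>] skew_mult_assoc[OF \<sigma>] h')
    then show "\<exists>r. p = skew_mult \<sigma> r g" by blast
  qed (auto simp: gen_left_ideal_skew)
  then show ?thesis by (simp add: constacyclic_code_def Let_def)
qed

text \<open>
  A code word is a left multiple \<open>r g\<close> of degree below \<open>n\<close>, which forces \<open>deg r < k\<close> as \<open>g\<close> is monic.
  So the words are the combinations of the shifts \<open>X^i g\<close> with \<open>i < k\<close>, and orthogonality needs
  to be tested on these shifts only.
\<close>

lemma dual_code_eq_parity_checks: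
  assumes lc: "lead_coeff g = 1" and deg: "degree g = n - k" and k: "k \<le> n"
    and h': "skew_mult \<sigma> h' g = constacyclic_poly n a"
  shows "dual_code n (constacyclic_code \<sigma> n a g) =
    {y \<in> carrier_vec n. \<forall>i<k. (\<Sum>j\<le>n - k. (\<sigma> ^^ i) (coeff g j) * y $ (i + j)) = 0}"
    (is "?D = ?P")
proof -
  \<comment> \<open>\<open>s i\<close> is the code word of the shift \<open>X^i g\<close>, padded with zeros.\<close>
  define s where "s i l = coeff (skew_mult \<sigma> (monom 1 i) g) l" for i l
  have s_eq: "s i l = (if i \<le> l then (\<sigma> ^^ i) (coeff g (l - i)) else 0)" for i l
    by (simp add: s_def coeff_monom_skew_mult[OF \<sigma>])
  have check: "(\<Sum>l<n. s i l * y $ l) = (\<Sum>j\<le>n - k. (\<sigma> ^^ i) (coeff g j) * y $ (i + j))"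
    if i: "i < k" for i and y :: "'a vec"
  proof -
    have "(\<Sum>l<n. s i l * y $ l) = (\<Sum>l\<in>(\<lambda>j. i + j) ` {..n - k}. s i l * y $ l)"
    proof (rule sum.mono_neutral_right)
      show "\<forall>l\<in>{..<n} - (\<lambda>j. i + j) ` {..n - k}. s i l * y $ l = 0"
      proof
        fix l assume l: "l \<in> {..<n} - (\<lambda>j. i + j) ` {..n - k}"
        show "s i l * y $ l = 0"
        proof (cases "i \<le> l")
          case True
          then have "l - i \<notin> {..n - k}" using l image_eqI[of l "\<lambda>j. i + j" "l - i"] by auto
          then have "n - k < l - i" by simp
          then show ?thesis by (simp add: s_eq coeff_eq_0 deg ring_auto_funpow(4)[OF \<sigma>])
        qed (simp add: s_eq)
      qed
    qed (use i k in auto)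
    also have "\<dots> = (\<Sum>j\<le>n - k. (\<sigma> ^^ i) (coeff g j) * y $ (i + j))"
      by (subst sum.reindex) (auto simp: s_eq)
    finally show ?thesis .
  qed
  have coeff_word: "coeff (\<Sum>i<n. monom (d i) i) l = (if l < n then d l else 0)"
    for d :: "nat \<Rightarrow> 'a" and l
    by (auto simp: coeff_sum)
  show ?thesis
  proof (intro subset_antisym subsetI)
    fix y assume y: "y \<in> ?D"
    then have yc: "y \<in> carrier_vec n" by (simp add: dual_code_def)
    have "(\<Sum>l<n. s i l * y $ l) = 0" if i: "i < k" for i
    proof -
      let ?x = "vec n (s i)"
      have "s i l = 0" if "\<not> l < n" for l
        using that i k by (simp add: s_eq coeff_eq_0 deg ring_auto_funpow(4)[OF \<sigma>])
      then have "(\<Sum>l<n. monom (?x $ l) l) = skew_mult \<sigma> (monom 1 i) g"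
        by (intro poly_eqI) (simp add: coeff_word flip: s_def)
      then have "?x \<in> constacyclic_code \<sigma> n a g"
        by (auto simp: constacyclic_code_eq[OF h'])
      then have "?x \<bullet> y = 0" using y by (auto simp: dual_code_def)
      then show ?thesis using yc by (simp add: scalar_prod_def atLeast0LessThan)
    qed
    then show "y \<in> ?P" using yc check by simp
  next
    fix y assume y: "y \<in> ?P"
    then have yc: "y \<in> carrier_vec n" by simp
    have "x \<bullet> y = 0" if x: "x \<in> constacyclic_code \<sigma> n a g" for x
    proof -
      from x obtain r where r: "(\<Sum>i<n. monom (x $ i) i) = skew_mult \<sigma> r g"
        by (auto simp: constacyclic_code_eq[OF h'])
      have r0: "coeff r i = 0" if "k \<le> i" for i
      proof (cases "r = 0")
        case False
        have "degree r + degree g < n"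
          by (rule degree_left_factor_less[OF \<sigma> lc _ False]) (simp flip: r add: coeff_word)
        then show ?thesis using that k by (intro coeff_eq_0) (simp add: deg)
      qed simp
      have x_eq: "x $ l = (\<Sum>i<k. coeff r i * s i l)" if l: "l < n" for l
      proof -
        have "x $ l = coeff (skew_mult \<sigma> r g) l" using l by (simp flip: r add: coeff_word)
        also have "\<dots> = (\<Sum>i\<le>l. coeff r i * s i l)"
          unfolding coeff_skew_mult[OF \<sigma>] by (intro sum.cong) (simp_all add: s_eq)
        also have "\<dots> = (\<Sum>i<k. coeff r i * s i l)"
          by (rule sum.mono_neutral_cong) (auto simp: r0 s_eq not_less not_le)
        finally show ?thesis .
      qed
      have "x \<bullet> y = (\<Sum>l<n. \<Sum>i<k. coeff r i * (s i l * y $ l))"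
        using yc by (simp add: scalar_prod_def atLeast0LessThan x_eq sum_distrib_right mult.assoc)
      also have "\<dots> = (\<Sum>i<k. coeff r i * (\<Sum>l<n. s i l * y $ l))"
        by (subst sum.swap) (simp add: sum_distrib_left)
      also have "\<dots> = 0" using y by (intro sum.neutral) (simp add: check)
      finally show ?thesis .
    qed
    then show "y \<in> ?D" using yc by (simp add: dual_code_def)
  qed
qed

text \<open>
  The coefficient of \<open>y $ (i + (n - k))\<close> in check \<open>i\<close> is \<open>\<sigma>^i(1) = 1\<close>, so the check reads as a
  recursion for this entry in terms of the \<open>n - k\<close> entries before it.
\<close>

lemma parity_checks_determine_tail:
  assumes lc: "lead_coeff g = 1" and deg: "degree g = n - k" and k: "k \<le> n"
    and y: "y \<in> carrier_vec n"
    and check: "\<And>i. i < k \<Longrightarrow> (\<Sum>j\<le>n - k. (\<sigma> ^^ i) (coeff g j) * y $ (i + j)) = 0"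
    and head: "\<And>j. j < n - k \<Longrightarrow> y $ j = 0"
  shows "y = 0\<^sub>v n"
proof -
  have "l < n \<Longrightarrow> y $ l = 0" for l
  proof (induction l rule: less_induct)
    case (less l)
    show ?case
    proof (cases "l < n - k")
      case False
      define i where "i = l - (n - k)"
      have i: "i < k" "i + (n - k) = l" using False less.prems k by (auto simp: i_def)
      have "(\<Sum>j\<le>n - k. (\<sigma> ^^ i) (coeff g j) * y $ (i + j)) =
          (\<Sum>j\<le>n - k. if j = n - k then y $ l else 0)"
      proof (intro sum.cong refl)
        fix j assume "j \<in> {..n - k}"
        then show "(\<sigma> ^^ i) (coeff g j) * y $ (i + j) = (if j = n - k then y $ l else 0)"
          using less i lc deg ring_auto_funpow(3)[OF \<sigma>, of i] by auto
      qed
      then show ?thesis using check[OF i(1)] by simp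
    qed (rule head)
  qed
  then show ?thesis using y by (intro eq_vecI) auto
qed

text \<open>
  The twist \<open>\<sigma>^(i+j)\<close> on the entry in column \<open>i + j\<close> is exactly what lets \<open>\<sigma>^i\<close> be pulled out of the
  check, leaving the convolution sum of the coefficient of \<open>g h\<close> at \<open>t + k - i\<close>.
\<close>

lemma dual_matrix_parity_checks:
  assumes deg: "degree g = n - k" and k: "k \<le> n" and degh: "degree h \<le> k"
    and gh: "skew_mult \<sigma> g h = constacyclic_poly n b" and t: "t < n - k" and i: "i < k"
  shows "(\<Sum>j\<le>n - k. (\<sigma> ^^ i) (coeff g j) * dual_matrix \<sigma> n k h $$ (t, i + j)) = 0"
proof -
  let ?l = "t + k - i"
  have "(\<Sum>j\<le>n - k. (\<sigma> ^^ i) (coeff g j) * dual_matrix \<sigma> n k h $$ (t, i + j)) =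
      (\<Sum>j\<le>?l. (\<sigma> ^^ i) (coeff g j * (\<sigma> ^^ j) (coeff h (?l - j))))"
  \<comment> \<open>The two index ranges differ only where a coefficient of \<open>g\<close> or a matrix entry is zero; on the
    common range with \<open>i + j < t\<close> the matrix entry is zero by definition, and the coefficient of \<open>h\<close>
    is one beyond its degree.\<close>
  proof (rule sum.mono_neutral_cong)
    fix j assume j: "j \<in> {..n - k} \<inter> {..?l}"
    then have ij: "t < n - k" "i + j < n" "i + j \<le> t + k" using t i k by auto
    have l: "t + k - (i + j) = ?l - j" by simp
    have "coeff h (?l - j) = 0" if "\<not> t \<le> i + j"
      using that degh by (intro coeff_eq_0) simp
    then have "dual_matrix \<sigma> n k h $$ (t, i + j) = (\<sigma> ^^ i) ((\<sigma> ^^ j) (coeff h (?l - j)))"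
      using ij by (cases "t \<le> i + j")
        (simp_all add: dual_matrix_def l funpow_add ring_auto_funpow(4)[OF \<sigma>] del: diff_diff_left)
    then show "(\<sigma> ^^ i) (coeff g j) * dual_matrix \<sigma> n k h $$ (t, i + j) =
        (\<sigma> ^^ i) (coeff g j * (\<sigma> ^^ j) (coeff h (?l - j)))"
      by (simp add: ring_auto_funpow(2)[OF \<sigma>])
  next
    fix j assume "j \<in> {..n - k} - {..?l}"
    then show "(\<sigma> ^^ i) (coeff g j) * dual_matrix \<sigma> n k h $$ (t, i + j) = 0"
      using t i k by (auto simp: dual_matrix_def)
  next
    fix j assume "j \<in> {..?l} - {..n - k}"
    then show "(\<sigma> ^^ i) (coeff g j * (\<sigma> ^^ j) (coeff h (?l - j))) = 0"
      using deg by (simp add: coeff_eq_0 ring_auto_funpow[OF \<sigma>])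
  qed auto
  also have "\<dots> = (\<sigma> ^^ i) (coeff (constacyclic_poly n b) ?l)"
    by (simp add: coeff_skew_mult[OF \<sigma>] funpow_sum[OF \<sigma>] flip: gh)
  also have "coeff (constacyclic_poly n b) ?l = 0"
    using t i k by (auto simp: constacyclic_poly_def coeff_pCons split: nat.splits)
  finally show ?thesis by (simp add: ring_auto_funpow(4)[OF \<sigma>])
qed

text \<open>
  Comparing coefficients at \<open>n\<close> in \<open>g h = X^n - b\<close> gives \<open>\<sigma>^(n-k)(h(k)) = 1\<close>. For \<open>n = 0\<close> the
  coefficient at \<open>n\<close> is \<open>1 - b\<close> instead, but then the matrix has no rows.
\<close>

lemma cofactor_monic:
  assumes lc: "lead_coeff g = 1" and deg: "degree g = n - k" and k: "k \<le> n" and n: "0 < n"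
    and degh: "degree h \<le> k" and gh: "skew_mult \<sigma> g h = constacyclic_poly n b"
  shows "coeff h k = 1"
proof -
  have "coeff (skew_mult \<sigma> g h) n =
      (\<Sum>i\<le>n. if i = n - k then (\<sigma> ^^ (n - k)) (coeff h k) else 0)"
    unfolding coeff_skew_mult[OF \<sigma>]
  proof (intro sum.cong refl)
    fix i assume "i \<in> {..n}"
    consider "i < n - k" | "i = n - k" | "i > n - k" by linarith
    then show "coeff g i * (\<sigma> ^^ i) (coeff h (n - i)) =
        (if i = n - k then (\<sigma> ^^ (n - k)) (coeff h k) else 0)"
    proof cases
      case 1
      then have "coeff h (n - i) = 0" using degh by (intro coeff_eq_0) auto
      then show ?thesis using 1 by (simp add: ring_auto_funpow(4)[OF \<sigma>])
    qed (use lc deg k in \<open>auto simp: coeff_eq_0\<close>)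
  qed
  then have "(\<sigma> ^^ (n - k)) (coeff h k) = coeff (constacyclic_poly n b) n"
    by (simp add: gh)
  also have "\<dots> = (\<sigma> ^^ (n - k)) 1"
    using n by (auto simp: constacyclic_poly_def coeff_pCons ring_auto_funpow(3)[OF \<sigma>]
        split: nat.splits)
  finally show ?thesis by (metis funpow_inv[OF \<sigma>])
qed

end

section \<open>Matrices with a unitriangular head\<close>

text \<open>
  Elimination with pivots \<open>1\<close> requires no division, which is why a basis results over an arbitrary
  commutative ring. Independence follows by reading off the coefficients of a vanishing combination
  at the pivots from left to right. For spanning, subtracting multiples of the rows clears the first
  \<open>m\<close> entries of a vector of \<open>M\<close>, and what is left is zero by the last hypothesis.
\<close>

lemma unitriangular_generating_matrix:
  fixes G :: "'a::comm_ring_1 mat"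
  assumes G: "G \<in> carrier_mat m n" and mn: "m \<le> n"
    and M: "submodule class_ring M (module_vec TYPE('a) n)"
    and rows: "\<And>t. t < m \<Longrightarrow> row G t \<in> M"
    and diag: "\<And>t. t < m \<Longrightarrow> G $$ (t, t) = 1"
    and low: "\<And>t j. t < m \<Longrightarrow> j < t \<Longrightarrow> G $$ (t, j) = 0"
    and head: "\<And>y. y \<in> M \<Longrightarrow> (\<And>j. j < m \<Longrightarrow> y $ j = 0) \<Longrightarrow> y = 0\<^sub>v n"
  shows "generating_matrix m n G M"
proof -
  interpret vec_module "TYPE('a)" n .
  let ?S = "set (rows G)"
  have S: "?S = row G ` {..<m}" using G by (auto simp: rows_def)
  have idx: "row G t $ j = G $$ (t, j)" if "t < m" "j < n" for t j using G that by simp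
  have Mc: "M \<subseteq> carrier_vec n"
    using LinearCombinations.submodule.subset[OF M] by (simp add: module_vec_simps)
  have SM: "?S \<subseteq> M" using rows by (auto simp: S)
  then have Sc: "?S \<subseteq> carrier_vec n" using Mc by blast
  have inj: "row G s \<noteq> row G t" if "s < t" "t < m" for s t
  proof
    assume "row G s = row G t"
    then have "row G s $ s = row G t $ s" by simp
    then show False using that mn by (simp add: idx diag low)
  qed
  have "distinct (rows G)"
    unfolding distinct_conv_nth
  proof (intro allI impI)
    fix s t assume "s < length (rows G)" "t < length (rows G)" "s \<noteq> t"
    then show "rows G ! s \<noteq> rows G ! t"
      using G inj[of s t] inj[of t s] by (cases "s < t") auto
  qed
  moreover have "\<not> lin_dep ?S"
  proof
    assume "lin_dep ?S"
    then obtain A c v where A: "finite A" "A \<subseteq> ?S" "lincomb c A = 0\<^sub>v n" "v \<in> A" "c v \<noteq> 0"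
      by (auto simp: lin_dep_def)
    have "row G t \<in> A \<longrightarrow> c (row G t) = 0" if "t < m" for t
      using that
    proof (induction t rule: less_induct)
      case (less t)
      show ?case
      proof
        assume tA: "row G t \<in> A"
        have Ac: "A \<subseteq> carrier_vec n" using A(2) Sc by blast
        have "0 = lincomb c A $ t" using A(3) less.prems mn by simp
        also have "\<dots> = (\<Sum>w\<in>A. c w * w $ t)"
          unfolding lincomb_def using less.prems mn Ac
          by (subst finsum_index) (auto intro!: sum.cong)
        also have "\<dots> = (\<Sum>w\<in>A. if w = row G t then c w else 0)"
        proof (intro sum.cong refl)
          fix w assume w: "w \<in> A"
          then obtain s where s: "s < m" "w = row G s" using A(2) by (auto simp: S)
          consider "s < t" | "s = t" | "t < s" by linarith
          then show "c w * w $ t = (if w = row G t then c w else 0)"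
          proof cases
            case 1
            then have "c (row G s) = 0" using less.IH[of s] w s by simp
            then show ?thesis using 1 inj[of s t] less.prems s(2) by simp
          next
            case 2
            then show ?thesis using s mn by (simp add: idx diag)
          next
            case 3
            then show ?thesis using s mn inj[of t s] by (auto simp: idx low)
          qed
        qed
        also have "\<dots> = c (row G t)" using A(1) tA by simp
        finally show "c (row G t) = 0" by simp
      qed
    qed
    then show False using A by (auto simp: S)
  qed
  moreover have "span ?S = M"
  proof
    show "span ?S \<subseteq> M" by (rule span_is_subset[OF SM M])
    have span: "submodule class_ring (span ?S) V" using span_is_submodule Sc by simp
    \<comment> \<open>Downward induction on the number \<open>l\<close> of leading zeros; \<open>l = m\<close> is the case of the zero vector.\<close>
    have "y \<in> span ?S" if "l \<le> m" "y \<in> M" "\<And>j. j < l \<Longrightarrow> y $ j = 0" for l y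
      using that
    proof (induction l arbitrary: y rule: inc_induct)
      case base
      then have "y = 0\<^sub>v n" by (intro head) auto
      then show ?case
        using LinearCombinations.submodule.zero_closed[OF span] by (simp add: module_vec_simps)
    next
      case (step l)
      let ?r = "row G l"
      have yc: "y \<in> carrier_vec n" and rc: "?r \<in> carrier_vec n"
        using step.prems(1) step.hyps rows Mc by auto
      define z where "z = y + (- y $ l) \<cdot>\<^sub>v ?r"
      have "(- y $ l) \<cdot>\<^sub>v ?r \<in> M"
        using LinearCombinations.submodule.smult_closed[OF M] rows step.hyps
        by (simp add: module_vec_simps)
      then have "z \<in> M"
        using LinearCombinations.submodule.m_closed[OF M] step.prems(1)
        by (simp add: module_vec_simps z_def)
      moreover have "z $ j = 0" if "j < Suc l" for j
      proof -
        have "z $ j = y $ j - y $ l * G $$ (l, j)"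
          using that step.hyps mn yc rc G by (simp add: z_def)
        then show ?thesis
          using that step by (cases "j = l") (auto simp: diag low)
      qed
      ultimately have "z \<in> span ?S" by (rule step.IH)
      moreover have "y $ l \<cdot>\<^sub>v ?r \<in> span ?S"
        using LinearCombinations.submodule.smult_closed[OF span] in_own_span[of ?S] Sc step.hyps
        by (auto simp: module_vec_simps S)
      ultimately have "z + y $ l \<cdot>\<^sub>v ?r \<in> span ?S"
        using LinearCombinations.submodule.m_closed[OF span] by (simp add: module_vec_simps)
      moreover have "z + y $ l \<cdot>\<^sub>v ?r = y"
        using yc G step.hyps by (intro eq_vecI) (auto simp: z_def)
      ultimately show ?case by simp
    qed
    then show "M \<subseteq> span ?S" by blast
  qed
  ultimately show ?thesis using G M by (simp add: generating_matrix_def)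
qed

section \<open>The generating matrix of the dual code\<close>

lemma submodule_dual_code:
  assumes "C \<subseteq> carrier_vec n"
  shows "submodule class_ring (dual_code n C) (module_vec TYPE('a::comm_ring_1) n)"
proof -
  interpret vec_module "TYPE('a)" n .
  show ?thesis
  proof (rule LinearCombinations.submodule.intro)
    show "Module.module class_ring V" by (rule module_axioms)
  qed (use assms in \<open>auto simp: dual_code_def module_vec_simps subset_eq
      scalar_prod_add_distrib[of _ n]\<close>)
qed

theorem corollary4p6:
  fixes \<sigma> :: "'a::{comm_ring_1, finite} \<Rightarrow> 'a"
    and a :: 'a and n k :: nat and g :: "'a poly" and C :: "'a vec set"
  assumes "\<sigma> \<in> ring_iso class_ring class_ring"
    and "a dvd 1"
    and "k \<le> n"
    and "degree g = n - k" and "lead_coeff g = 1"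
    and "coeff g 0 dvd 1"
    and "right_divisor (skew_poly_ring \<sigma>) g (constacyclic_poly n a)"
    and "C = constacyclic_code \<sigma> n a g"
  shows "(\<exists>h. degree h \<le> k \<and>
            g \<otimes>\<^bsub>skew_poly_ring \<sigma>\<^esub> h = constacyclic_poly n ((inv_into UNIV \<sigma> ^^ k) a)) \<and>
         (\<forall>h. degree h \<le> k \<and>
            g \<otimes>\<^bsub>skew_poly_ring \<sigma>\<^esub> h = constacyclic_poly n ((inv_into UNIV \<sigma> ^^ k) a) \<longrightarrow>
            generating_matrix (n - k) n (dual_matrix \<sigma> n k h) (dual_code n C))"
proof -
  note \<sigma> = assms(1) and k = assms(3) and deg = assms(4) and lc = assms(5)
  let ?b = "(inv_into UNIV \<sigma> ^^ k) a"
  have mult: "p \<otimes>\<^bsub>skew_poly_ring \<sigma>\<^esub> q = skew_mult \<sigma> p q" for p q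
    by (simp add: skew_poly_ring_def)
  from assms(7) obtain h' where h': "skew_mult \<sigma> h' g = constacyclic_poly n a"
    by (auto simp: right_divisor_def mult)
  have "degree h' \<le> k"
  proof (cases "h' = 0")
    case False
    have "degree h' + degree g < Suc n"
      by (rule degree_left_factor_less[OF \<sigma> lc _ False])
        (auto simp: h' constacyclic_poly_def coeff_pCons split: nat.splits)
    then show ?thesis using deg k by simp
  qed simp
  moreover have "degree (map_poly (inv_into UNIV \<sigma> ^^ n) h') \<le> degree h'"
    by (rule degree_le) (simp add: coeff_map_poly coeff_eq_0
        ring_auto_funpow(4)[OF inv_ring_auto[OF \<sigma>]])
  moreover note monic_left_divisor[OF \<sigma> lc deg k h']
  ultimately have "\<exists>h. degree h \<le> k \<and> skew_mult \<sigma> g h = constacyclic_poly n ?b"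
    by (meson order_trans)
  moreover have "generating_matrix (n - k) n (dual_matrix \<sigma> n k h) (dual_code n C)"
    if degh: "degree h \<le> k" and gh: "skew_mult \<sigma> g h = constacyclic_poly n ?b" for h
  proof (rule unitriangular_generating_matrix)
    note D = dual_code_eq_parity_checks[OF \<sigma> lc deg k h', folded assms(8)]
    let ?H = "dual_matrix \<sigma> n k h"
    show H: "?H \<in> carrier_mat (n - k) n" by (simp add: dual_matrix_def)
    show "submodule class_ring (dual_code n C) (module_vec TYPE('a) n)"
      by (rule submodule_dual_code) (auto simp: assms(8) constacyclic_code_def Let_def)
    show "row ?H t \<in> dual_code n C" if t: "t < n - k" for t
    proof -
      have "(\<Sum>j\<le>n - k. (\<sigma> ^^ i) (coeff g j) * row ?H t $ (i + j)) = 0" if i: "i < k" for i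
      proof -
        have "row ?H t $ (i + j) = ?H $$ (t, i + j)" if "j \<le> n - k" for j
          using H t i k that by simp
        then show ?thesis
          using dual_matrix_parity_checks[OF \<sigma> deg k degh gh t i] by simp
      qed
      moreover have "row ?H t \<in> carrier_vec n" using H t by (intro carrier_vecI) simp
      ultimately show ?thesis by (simp add: D)
    qed
    show "?H $$ (t, t) = 1" if "t < n - k" for t
      using that cofactor_monic[OF \<sigma> lc deg k _ degh gh]
      by (simp add: dual_matrix_def ring_auto_funpow(3)[OF \<sigma>])
    show "?H $$ (t, j) = 0" if "t < n - k" "j < t" for t j
      using that by (simp add: dual_matrix_def)
    show "y = 0\<^sub>v n" if "y \<in> dual_code n C" "\<And>j. j < n - k \<Longrightarrow> y $ j = 0" for y
      using that by (intro parity_checks_determine_tail[OF \<sigma> lc deg k]) (auto simp: D)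
  qed simp
  ultimately show ?thesis by (simp add: mult)
qed

end
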